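(* Let $p\ge 2$ be an integer and let $P_n$ be the path on $n$ vertices. If $\gamma_p(P_n)>p$, then $r_p(P_n)=2$ if $p=2$ and $n$ is odd; $r_p(P_n)=1$ if $p=2$ and $n$ is even; and $r_p(P_n)=p-2$ if $p\ge 3$.
   Context: For a graph $G=(V,E)$, a set $D\subseteq V$ is a $p$-dominating set if every vertex $x\notin D$ has at least $p$ neighbours in $D$; $\gamma_p(G)$ is the minimum size of a $p$-dominating set. For $B\subseteq E(G^c)$ (edges of the complement), $G+B=(V,E\cup B)$. The $p$-reinforcement number is $r_p(G)=\min\{|B| : B\subseteq E(G^c),\ \gamma_p(G+B)<\gamma_p(G)\}$, with the convention $r_p(G)=0$ if $\gamma_p(G)\le p$. *)

theory Defs
  imports Main
begin

type_synonym 'a ugraph = "'a set \<times> 'a set set"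

abbreviation verts :: "'a ugraph \<Rightarrow> 'a set" where
  "verts G \<equiv> fst G"

abbreviation edges :: "'a ugraph \<Rightarrow> 'a set set" where
  "edges G \<equiv> snd G"

definition simple_graph :: "'a ugraph \<Rightarrow> bool" where
  "simple_graph G \<longleftrightarrow> finite (verts G) \<and> (\<forall>e\<in>edges G. e \<subseteq> verts G \<and> card e = 2)"

definition neighbours :: "'a ugraph \<Rightarrow> 'a \<Rightarrow> 'a set" where
  "neighbours G x = {y \<in> verts G. {x, y} \<in> edges G}"

definition p_dominating :: "nat \<Rightarrow> 'a ugraph \<Rightarrow> 'a set \<Rightarrow> bool" where
  "p_dominating p G D \<longleftrightarrow>
     D \<subseteq> verts G \<and> (\<forall>x \<in> verts G - D. card (neighbours G x \<inter> D) \<ge> p)"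

text \<open>The vertex set is always p-dominating, so the minimum below is attained.\<close>

definition p_domination_number :: "nat \<Rightarrow> 'a ugraph \<Rightarrow> nat" where
  "p_domination_number p G = (LEAST k. \<exists>D. p_dominating p G D \<and> card D = k)"

definition complement_edges :: "'a ugraph \<Rightarrow> 'a set set" where
  "complement_edges G = {e. e \<subseteq> verts G \<and> card e = 2 \<and> e \<notin> edges G}"

definition add_edges :: "'a ugraph \<Rightarrow> 'a set set \<Rightarrow> 'a ugraph" where
  "add_edges G B = (verts G, edges G \<union> B)"

text \<open>
  If \<open>p_domination_number p G > p\<close> for a simple graph, adding all complement edges gives
  a complete graph, in which any \<open>p\<close> vertices are p-dominating; so the minimum below is
  over a nonempty set.
\<close>

definition p_reinforcement_number :: "nat \<Rightarrow> 'a ugraph \<Rightarrow> nat" where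
  "p_reinforcement_number p G =
     (if p_domination_number p G \<le> p then 0
      else (LEAST k. \<exists>B \<subseteq> complement_edges G.
              p_domination_number p (add_edges G B) < p_domination_number p G \<and> card B = k))"

definition path_graph :: "nat \<Rightarrow> nat ugraph" where
  "path_graph n = ({..<n}, {{i, Suc i} | i. Suc i < n})"

lemma simple_graph_path_graph: "simple_graph (path_graph n)"
  by (auto simp: simple_graph_def path_graph_def card_insert_if)

end

theory Submission
  imports Defs
begin

text \<open>
  Double counting the edges between a \<open>p\<close>-dominating set \<open>D\<close> and its complement gives
  \<open>p * (|V| - |D|) \<le> |E|\<close>. For \<open>p = 2\<close> this bounds the domination number of a path, and of a
  path with one extra edge, from below; alternating vertices show that the bounds are sharp.
  For \<open>p \<ge> 3\<close> every vertex of a path has degree below \<open>p\<close>, so only the full vertex set dominates,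
  and dropping a vertex requires raising its degree from at most 2 to \<open>p\<close>.
\<close>

section \<open>Domination numbers and added edges in arbitrary graphs\<close>

lemma p_domination_number_le:
  assumes "p_dominating p G D"
  shows "p_domination_number p G \<le> card D"
  unfolding p_domination_number_def using assms by (blast intro: Least_le)

lemma p_dominating_verts: "p_dominating p G (verts G)"
  by (simp add: p_dominating_def)

lemma obtain_minimum_p_dominating:
  obtains D where "p_dominating p G D" "card D = p_domination_number p G"
proof -
  have "\<exists>D. p_dominating p G D \<and> card D = p_domination_number p G"
    unfolding p_domination_number_def
    by (rule LeastI_ex) (use p_dominating_verts in blast)
  then show ?thesis using that by blast
qed

lemma finite_edges:
  assumes "simple_graph G"
  shows "finite (edges G)"
proof -
  have "edges G \<subseteq> Pow (verts G)" "finite (verts G)"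
    using assms by (auto simp: simple_graph_def)
  then show ?thesis by (meson finite_Pow_iff finite_subset)
qed

lemma finite_complement_edges:
  assumes "finite (verts G)"
  shows "finite (complement_edges G)"
proof -
  have "complement_edges G \<subseteq> Pow (verts G)"
    by (auto simp: complement_edges_def)
  then show ?thesis using assms by (meson finite_Pow_iff finite_subset)
qed

lemma simple_graph_add_edges:
  assumes "simple_graph G" "B \<subseteq> complement_edges G"
  shows "simple_graph (add_edges G B)"
  using assms by (auto simp: simple_graph_def add_edges_def complement_edges_def)

lemma p_dominating_card_edges:
  assumes G: "simple_graph G" and D: "p_dominating p G D"
  shows "p * (card (verts G) - card D) \<le> card (edges G)"
proof -
  let ?S = "SIGMA x:verts G - D. neighbours G x \<inter> D"
  have fin: "finite (verts G)" and DV: "D \<subseteq> verts G"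
    using G D by (auto simp: simple_graph_def p_dominating_def)
  have finN: "finite (neighbours G x \<inter> D)" for x
    using fin by (simp add: neighbours_def)
  have "p * (card (verts G) - card D) = (\<Sum>x\<in>verts G - D. p)"
    using fin DV by (simp add: card_Diff_subset finite_subset)
  also have "\<dots> \<le> (\<Sum>x\<in>verts G - D. card (neighbours G x \<inter> D))"
    using D by (intro sum_mono) (auto simp: p_dominating_def)
  also have "\<dots> = card ?S"
    using fin finN by (simp add: card_SigmaI)
  also have "\<dots> \<le> card (edges G)"
  proof (rule card_inj_on_le)
    \<comment> \<open>An unordered edge determines its ordered pair because \<open>x\<close> lies
      outside \<open>D\<close> and \<open>y\<close> inside it.\<close>
    show "inj_on (\<lambda>(x, y). {x, y}) ?S"
      by (auto simp: inj_on_def doubleton_eq_iff)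
    show "(\<lambda>(x, y). {x, y}) ` ?S \<subseteq> edges G"
      by (auto simp: neighbours_def)
    show "finite (edges G)" using G by (rule finite_edges)
  qed
  finally show ?thesis .
qed

text \<open>Once \<open>x\<close> is fixed, an edge \<open>{x, y}\<close> of \<open>B\<close>
  determines \<open>y\<close>, so each added edge contributes at most one new neighbour of
  \<open>x\<close>.\<close>

lemma card_neighbours_add_edges:
  assumes "finite (verts G)" "finite B"
  shows "card (neighbours (add_edges G B) x) \<le> card (neighbours G x) + card B"
proof -
  let ?M = "{y \<in> verts G. {x, y} \<in> B}"
  have "neighbours (add_edges G B) x = neighbours G x \<union> ?M"
    by (auto simp: neighbours_def add_edges_def)
  then have "card (neighbours (add_edges G B) x) \<le> card (neighbours G x) + card ?M"
    by (simp add: card_Un_le)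
  moreover have "card ?M \<le> card B"
    by (rule card_inj_on_le[where f = "\<lambda>y. {x, y}"])
      (use assms in \<open>auto simp: inj_on_def doubleton_eq_iff\<close>)
  ultimately show ?thesis by linarith
qed

text \<open>Splits the computation into a witness of size \<open>k\<close> and a lower bound for
  every successful edge set. The first assumption excludes the conventional value 0.\<close>

lemma p_reinforcement_number_eqI:
  assumes "p_domination_number p G > p"
    and "B \<subseteq> complement_edges G" "card B = k"
    and "p_domination_number p (add_edges G B) < p_domination_number p G"
    and "\<And>B'. \<lbrakk>B' \<subseteq> complement_edges G;
            p_domination_number p (add_edges G B') < p_domination_number p G\<rbrakk> \<Longrightarrow> k \<le> card B'"
  shows "p_reinforcement_number p G = k"
proof -
  have "(LEAST k. \<exists>B \<subseteq> complement_edges G.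
      p_domination_number p (add_edges G B) < p_domination_number p G \<and> card B = k) = k"
    by (rule Least_equality) (use assms in blast)+
  then show ?thesis
    using assms(1) by (simp add: p_reinforcement_number_def)
qed

section \<open>Edges and degrees of paths\<close>

lemma verts_path_graph [simp]: "verts (path_graph n) = {..<n}"
  by (simp add: path_graph_def)

lemma verts_add_edges [simp]: "verts (add_edges G B) = verts G"
  by (simp add: add_edges_def)

lemma edges_path_graph_iff:
  "{x, y} \<in> edges (path_graph n) \<longleftrightarrow> x < n \<and> y < n \<and> (y = Suc x \<or> x = Suc y)"
  by (auto simp: path_graph_def doubleton_eq_iff)

lemma complement_edges_path_graph_iff:
  "{x, y} \<in> complement_edges (path_graph n) \<longleftrightarrow>
     x < n \<and> y < n \<and> x \<noteq> y \<and> y \<noteq> Suc x \<and> x \<noteq> Suc y"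
  by (auto simp: complement_edges_def edges_path_graph_iff card_insert_if)

lemma card_edges_path_graph: "card (edges (path_graph n)) \<le> n - 1"
proof -
  have "edges (path_graph n) = (\<lambda>i. {i, Suc i}) ` {..<n - 1}"
    by (auto simp: path_graph_def)
  then show ?thesis
    by (metis card_image_le card_lessThan finite_lessThan)
qed

lemma card_neighbours_path_graph: "card (neighbours (path_graph n) x) \<le> 2"
proof -
  \<comment> \<open>For \<open>x = 0\<close> truncated subtraction gives \<open>x - 1 = 0\<close>;
    this is harmless, since only an inclusion is claimed.\<close>
  have "neighbours (path_graph n) x \<subseteq> {x - 1, Suc x}"
    by (auto simp: neighbours_def edges_path_graph_iff)
  then have "card (neighbours (path_graph n) x) \<le> card {x - 1, Suc x}"
    by (intro card_mono) auto
  also have "\<dots> \<le> 2" by (simp add: card_insert_if)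
  finally show ?thesis .
qed

lemma finite_complement_edges_path_graph:
  "B \<subseteq> complement_edges (path_graph n) \<Longrightarrow> finite B"
  using finite_complement_edges[of "path_graph n"] by (auto intro: finite_subset)

section \<open>The case \<open>p = 2\<close>\<close>

text \<open>Reduces the domination condition at \<open>x\<close> to naming two distinct neighbours
  in \<open>D\<close>.\<close>

lemma two_le_card_neighbours:
  assumes "finite (verts G)" "y \<noteq> z" "y \<in> verts G" "z \<in> verts G" "y \<in> D" "z \<in> D"
    and "{x, y} \<in> edges G" "{x, z} \<in> edges G"
  shows "2 \<le> card (neighbours G x \<inter> D)"
proof -
  have "{y, z} \<subseteq> neighbours G x \<inter> D"
    using assms by (auto simp: neighbours_def)
  then have "card {y, z} \<le> card (neighbours G x \<inter> D)"
    using assms(1) by (intro card_mono) (auto simp: neighbours_def)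
  then show ?thesis using assms(2) by simp
qed

text \<open>Double counting for a minimum 2-dominating set of the augmented path, which has at most
  \<open>n - 1 + card B\<close> edges. The additive form avoids truncated subtraction of the
  domination number.\<close>

lemma two_domination_number_path_add_edges_ge:
  assumes "n > 0" and B: "B \<subseteq> complement_edges (path_graph n)"
  shows "2 * n \<le> 2 * p_domination_number 2 (add_edges (path_graph n) B) + (n - 1) + card B"
proof -
  let ?G = "add_edges (path_graph n) B"
  obtain D where D: "p_dominating 2 ?G D" "card D = p_domination_number 2 ?G"
    by (rule obtain_minimum_p_dominating)
  have "2 * (n - card D) \<le> card (edges ?G)"
    using p_dominating_card_edges[OF simple_graph_add_edges[OF simple_graph_path_graph B] D(1)]
    by simp
  also have "\<dots> \<le> card (edges (path_graph n)) + card B"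
    by (simp add: add_edges_def card_Un_le)
  also have "\<dots> \<le> (n - 1) + card B"
    using card_edges_path_graph by simp
  finally show ?thesis using D(2) by linarith
qed

lemma add_edges_empty [simp]: "add_edges G {} = G"
  by (simp add: add_edges_def)

text \<open>By parity, this gives at least \<open>m + 1\<close> both for \<open>n = 2 * m\<close>
  and for \<open>n = 2 * m + 1\<close>.\<close>

lemma two_domination_number_path_ge:
  assumes "n > 0"
  shows "n + 1 \<le> 2 * p_domination_number 2 (path_graph n)"
  using two_domination_number_path_add_edges_ge[OF assms, of "{}"] assms by simp

lemma two_reinforcement_number_path_even:
  assumes "p_domination_number 2 (path_graph n) > 2" "even n"
  shows "p_reinforcement_number 2 (path_graph n) = 1"
proof -
  obtain m where n: "n = 2 * m" using assms(2) by blast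
  \<comment> \<open>The full vertex set dominates, so the hypothesis forces more than two vertices;
    the two ends of the path are then nonadjacent.\<close>
  have "n > 2"
    using assms(1) p_domination_number_le[OF p_dominating_verts, of 2 "path_graph n"] by simp
  then have m: "m \<ge> 2" using n by simp
  \<comment> \<open>The even vertices fail to dominate only the end \<open>2 * m - 1\<close>, which
    has a single neighbour. Closing the path to a cycle gives it the second neighbour 0.\<close>
  let ?B = "{{0, 2 * m - 1}}" and ?D = "(\<lambda>i. 2 * i) ` {..<m}"
  show ?thesis
  proof (rule p_reinforcement_number_eqI[OF assms(1), of ?B])
    show "?B \<subseteq> complement_edges (path_graph n)"
      using m n by (auto simp: complement_edges_path_graph_iff)
    let ?G = "add_edges (path_graph n) ?B"
    have "p_dominating 2 ?G ?D"
      unfolding p_dominating_def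
    proof (intro conjI ballI)
      show "?D \<subseteq> verts ?G" using n by auto
      fix x assume x: "x \<in> verts ?G - ?D"
      then have "odd x" using n by (auto elim!: evenE)
      then obtain i where i: "x = 2 * i + 1" by (blast elim: oddE)
      have im: "i < m" using x i n by simp
      show "2 \<le> card (neighbours ?G x \<inter> ?D)"
      proof (cases "i + 1 < m")
        case True
        then have "2 * (i + 1) \<in> ?D" by blast
        then show ?thesis
          by (intro two_le_card_neighbours[of _ "2 * i" "2 * (i + 1)"])
            (use True i n in \<open>auto simp: add_edges_def edges_path_graph_iff\<close>)
      next
        case False
        then have "x = 2 * m - 1" "i = m - 1" using i im by auto
        then show ?thesis
          by (intro two_le_card_neighbours[of _ "2 * i" 0])
            (use i n m in \<open>auto simp: add_edges_def edges_path_graph_iff insert_commute\<close>)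
      qed
    qed
    then have "p_domination_number 2 ?G \<le> card ?D" by (rule p_domination_number_le)
    also have "card ?D = m" by (simp add: card_image inj_on_def)
    finally show "p_domination_number 2 ?G < p_domination_number 2 (path_graph n)"
      using two_domination_number_path_ge[of n] m n by simp
  next
    fix B assume B: "B \<subseteq> complement_edges (path_graph n)"
      and "p_domination_number 2 (add_edges (path_graph n) B) < p_domination_number 2 (path_graph n)"
    then have "B \<noteq> {}" by auto
    then show "1 \<le> card B"
      using finite_complement_edges_path_graph[OF B] by (simp add: Suc_le_eq card_gt_0_iff)
  qed simp
qed

text \<open>The even vertices include both ends, so every odd vertex lies between two of
  them.\<close>

lemma two_domination_number_path_odd_le:
  "p_domination_number 2 (path_graph (2 * m + 1)) \<le> m + 1"
proof -
  let ?D = "(\<lambda>i. 2 * i) ` {..m}" and ?G = "path_graph (2 * m + 1)"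
  have "p_dominating 2 ?G ?D"
    unfolding p_dominating_def
  proof (intro conjI ballI)
    show "?D \<subseteq> verts ?G" by auto
    fix x assume x: "x \<in> verts ?G - ?D"
    then have "odd x" by (auto elim!: evenE)
    then obtain i where i: "x = 2 * i + 1" by (blast elim: oddE)
    have "2 * (i + 1) \<in> ?D" using i x by (intro imageI) simp
    then show "2 \<le> card (neighbours ?G x \<inter> ?D)"
      by (intro two_le_card_neighbours[of _ "2 * i" "2 * (i + 1)"])
        (use i x in \<open>auto simp: edges_path_graph_iff\<close>)
  qed
  then have "p_domination_number 2 ?G \<le> card ?D" by (rule p_domination_number_le)
  also have "card ?D = m + 1" by (simp add: card_image inj_on_def)
  finally show ?thesis .
qed

lemma two_reinforcement_number_path_odd:
  assumes "p_domination_number 2 (path_graph n) > 2" "odd n"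
  shows "p_reinforcement_number 2 (path_graph n) = 2"
proof -
  obtain m where n: "n = 2 * m + 1" using assms(2) by (blast elim: oddE)
  have le: "p_domination_number 2 (path_graph n) \<le> m + 1"
    using two_domination_number_path_odd_le n by simp
  then have m: "m \<ge> 2" using assms(1) by simp
  \<comment> \<open>The \<open>m\<close> odd vertices dominate every inner even vertex, but each end
    of the path has only one neighbour among them. Each new edge supplies the missing one;
    \<open>m \<ge> 2\<close> makes 3 a vertex and keeps \<open>2 * m\<close> nonadjacent to
    1.\<close>
  let ?B = "{{0, 3}, {2 * m, 1}}" and ?D = "(\<lambda>i. 2 * i + 1) ` {..<m}"
  show ?thesis
  proof (rule p_reinforcement_number_eqI[OF assms(1), of ?B])
    show "?B \<subseteq> complement_edges (path_graph n)"
      using m n by (auto simp: complement_edges_path_graph_iff)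
    show "card ?B = 2" using m by (simp add: doubleton_eq_iff)
    let ?G = "add_edges (path_graph n) ?B"
    have "p_dominating 2 ?G ?D"
      unfolding p_dominating_def
    proof (intro conjI ballI)
      show "?D \<subseteq> verts ?G" using n by auto
      fix x assume x: "x \<in> verts ?G - ?D"
      then have "even x" using n by (cases "even x") (auto elim!: oddE)
      then obtain i where i: "x = 2 * i" by blast
      have im: "i \<le> m" using x i n by simp
      have one: "1 \<in> ?D" using m by (auto intro: image_eqI[of _ _ 0])
      have three: "3 \<in> ?D" using m by (auto intro: image_eqI[of _ _ 1])
      have last: "2 * m - 1 \<in> ?D" using m by (auto intro!: image_eqI[of _ _ "m - 1"])
      consider "i = 0" | "i = m" | "0 < i" "i < m" using im by linarith
      then show "2 \<le> card (neighbours ?G x \<inter> ?D)"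
      proof cases
        case 1
        show ?thesis
          by (rule two_le_card_neighbours[of _ 1 3])
            (use 1 i n m one three in \<open>auto simp: add_edges_def edges_path_graph_iff\<close>)
      next
        case 2
        show ?thesis
          by (rule two_le_card_neighbours[of _ "2 * m - 1" 1])
            (use 2 i n m one last in \<open>auto simp: add_edges_def edges_path_graph_iff\<close>)
      next
        case 3
        then have "2 * i - 1 \<in> ?D" by (auto intro!: image_eqI[of _ _ "i - 1"])
        then show ?thesis
          by (intro two_le_card_neighbours[of _ "2 * i - 1" "2 * i + 1"])
            (use 3 i n m in \<open>auto simp: add_edges_def edges_path_graph_iff\<close>)
      qed
    qed
    then have "p_domination_number 2 ?G \<le> card ?D" by (rule p_domination_number_le)
    also have "card ?D = m" by (simp add: card_image inj_on_def)
    finally show "p_domination_number 2 ?G < p_domination_number 2 (path_graph n)"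
      using two_domination_number_path_ge[of n] m n by simp
  next
    fix B assume "B \<subseteq> complement_edges (path_graph n)"
      and "p_domination_number 2 (add_edges (path_graph n) B) < p_domination_number 2 (path_graph n)"
    \<comment> \<open>A domination number of at most \<open>m\<close> turns the counting bound into
      \<open>4 * m + 2 \<le> 4 * m + card B\<close>.\<close>
    then show "2 \<le> card B"
      using two_domination_number_path_add_edges_ge[of n B] le n by simp
  qed
qed

section \<open>The case \<open>p \<ge> 3\<close>\<close>

text \<open>All degrees are at most \<open>2 + card B < p\<close>, so no vertex can be left out of a
  dominating set. With \<open>B\<close> empty this evaluates the domination number of the path
  itself; in general it shows that fewer than \<open>p - 2\<close> edges change nothing.\<close>

lemma p_domination_number_path_add_edges:
  assumes B: "B \<subseteq> complement_edges (path_graph n)" and p: "card B + 2 < p"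
  shows "p_domination_number p (add_edges (path_graph n) B) = n"
proof -
  let ?G = "add_edges (path_graph n) B"
  obtain D where D: "p_dominating p ?G D" "card D = p_domination_number p ?G"
    by (rule obtain_minimum_p_dominating)
  have "card (neighbours ?G x \<inter> D) < p" for x
  proof -
    have "card (neighbours ?G x \<inter> D) \<le> card (neighbours ?G x)"
      by (intro card_mono) (auto simp: neighbours_def)
    also have "\<dots> \<le> card (neighbours (path_graph n) x) + card B"
      by (intro card_neighbours_add_edges finite_complement_edges_path_graph[OF B]) simp
    also have "\<dots> < p" using card_neighbours_path_graph[of n x] p by simp
    finally show ?thesis .
  qed
  then have "D = {..<n}"
    using D(1) by (force simp: p_dominating_def not_le[symmetric])
  then show ?thesis using D(2) by simp
qed

lemma p_reinforcement_number_path: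
  assumes "p_domination_number p (path_graph n) > p" "p \<ge> 3"
  shows "p_reinforcement_number p (path_graph n) = p - 2"
proof -
  have \<gamma>: "p_domination_number p (path_graph n) = n"
    using p_domination_number_path_add_edges[of "{}" n p] assms(2) by simp
  then have n: "n > p" using assms(1) by simp
  let ?B = "(\<lambda>y. {1, y}) ` {3..<p + 1}"
  show ?thesis
  proof (rule p_reinforcement_number_eqI[OF assms(1), of ?B])
    show "?B \<subseteq> complement_edges (path_graph n)"
      using n by (auto simp: complement_edges_path_graph_iff)
    show "card ?B = p - 2"
      by (subst card_image) (auto simp: inj_on_def doubleton_eq_iff)
    let ?G = "add_edges (path_graph n) ?B" and ?D = "{..<n} - {1}"
    have "p_dominating p ?G ?D"
      unfolding p_dominating_def
    proof (intro conjI ballI)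
      fix x assume "x \<in> verts ?G - ?D"
      then have x: "x = 1" by auto
      \<comment> \<open>These are exactly \<open>p\<close> vertices: 0 and 2 are adjacent to 1 along
        the path, the others through \<open>?B\<close>.\<close>
      have "y \<in> neighbours ?G x \<inter> ?D" if "y \<in> insert 0 {2..<p + 1}" for y
        using that x n assms(2)
        by (cases "y = 2")
          (auto simp: neighbours_def add_edges_def edges_path_graph_iff)
      then have "card (insert 0 {2..<p + 1}) \<le> card (neighbours ?G x \<inter> ?D)"
        by (intro card_mono) auto
      then show "p \<le> card (neighbours ?G x \<inter> ?D)" using assms(2) by simp
    qed auto
    then have "p_domination_number p ?G \<le> card ?D" by (rule p_domination_number_le)
    also have "card ?D < n" using n assms(2) by simp
    finally show "p_domination_number p ?G < p_domination_number p (path_graph n)"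
      using \<gamma> by simp
  next
    fix B assume "B \<subseteq> complement_edges (path_graph n)"
      and "p_domination_number p (add_edges (path_graph n) B) < p_domination_number p (path_graph n)"
    then show "p - 2 \<le> card B"
      using p_domination_number_path_add_edges[of B n p] \<gamma> by linarith
  qed
qed

theorem theorem3p2:
  fixes p n :: nat
  assumes "p \<ge> 2"
    and "p_domination_number p (path_graph n) > p"
  shows "(p = 2 \<and> odd n \<longrightarrow> p_reinforcement_number p (path_graph n) = 2) \<and>
         (p = 2 \<and> even n \<longrightarrow> p_reinforcement_number p (path_graph n) = 1) \<and>
         (p \<ge> 3 \<longrightarrow> p_reinforcement_number p (path_graph n) = p - 2)"
  using assms two_reinforcement_number_path_odd two_reinforcement_number_path_even
    p_reinforcement_number_path by blast

end
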